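(* Let $p$ and $q$ be positive coprime integers with $p\geqslant 59\,q$, and let $$Q_{pq}(t)=t^{10}+(2q^2+p^2)(3q^2-2p^2)\,t^8+(q^8+10p^2q^6+4p^4q^4-14p^6q^2+p^8)\,t^6-p^2q^2(q^8-14p^2q^6+4p^4q^4+10p^6q^2+p^8)\,t^4-p^6q^6(q^2+2p^2)(3p^2-2q^2)\,t^2-q^{10}p^{10}.$$ Then the equation $Q_{pq}(t)=0$ has at least one real root $t$ satisfying $$p^2-2qp-2q^2-\frac{9q^3}{p}<t<p^2-2qp-2q^2.$$ *)

theory Defs
  imports Complex_Main
begin

definition Q :: "int \<Rightarrow> int \<Rightarrow> real \<Rightarrow> real" where
  "Q p q t =
     t ^ 10
   + of_int ((2 * q ^ 2 + p ^ 2) * (3 * q ^ 2 - 2 * p ^ 2)) * t ^ 8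
   + of_int (q ^ 8 + 10 * p ^ 2 * q ^ 6 + 4 * p ^ 4 * q ^ 4 - 14 * p ^ 6 * q ^ 2 + p ^ 8) * t ^ 6
   - of_int (p ^ 2 * q ^ 2 * (q ^ 8 - 14 * p ^ 2 * q ^ 6 + 4 * p ^ 4 * q ^ 4 + 10 * p ^ 6 * q ^ 2 + p ^ 8)) * t ^ 4
   - of_int (p ^ 6 * q ^ 6 * (q ^ 2 + 2 * p ^ 2) * (3 * p ^ 2 - 2 * q ^ 2)) * t ^ 2
   - of_int (q ^ 10 * p ^ 10)"

end

theory Submission
  imports Defs
begin

text \<open>
  The polynomial is homogeneous: with \<open>x = q / p\<close> and \<open>t = p\<^sup>2 s\<close> it equals \<open>p\<^sup>2\<^sup>0\<close> times a
  polynomial in \<open>x\<close> and \<open>s\<close>. At the rescaled end points \<open>1 - 2x - 2x\<^sup>2 - 9x\<^sup>3\<close> and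
  \<open>1 - 2x - 2x\<^sup>2\<close> its lowest-order terms in \<open>x\<close> are \<open>64x\<^sup>4\<close> and \<open>-80x\<^sup>4\<close>, which dominate the
  remainder for \<open>x \<le> 1/59\<close>, so the intermediate value theorem applies.
\<close>

definition Q_scaled :: "real \<Rightarrow> real \<Rightarrow> real" where
  "Q_scaled x s =
     s ^ 10
   + (2 * x ^ 2 + 1) * (3 * x ^ 2 - 2) * s ^ 8
   + (x ^ 8 + 10 * x ^ 6 + 4 * x ^ 4 - 14 * x ^ 2 + 1) * s ^ 6
   - x ^ 2 * (x ^ 8 - 14 * x ^ 6 + 4 * x ^ 4 + 10 * x ^ 2 + 1) * s ^ 4
   - x ^ 6 * (x ^ 2 + 2) * (3 - 2 * x ^ 2) * s ^ 2
   - x ^ 10"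

text \<open>Writing the ratio as a product keeps both sides polynomial, so a ring identity remains
  after substitution.\<close>

lemma Q_eq_Q_scaled:
  assumes "real_of_int q = x * of_int p"
  shows "Q p q (of_int p ^ 2 * s) = of_int p ^ 20 * Q_scaled x s"
  unfolding Q_def Q_scaled_def of_int_add of_int_diff of_int_mult of_int_power of_int_numeral assms
  by algebra

lemma continuous_on_Q_scaled: "continuous_on A (Q_scaled x)"
  unfolding Q_scaled_def by (intro continuous_intros)

text \<open>At \<open>x = 0\<close> the polynomial is \<open>s^6 * (s^2 - 1)^2\<close>. Its double
  zero \<open>s = 1\<close> splits into branches starting \<open>1 + 2x\<close> and
  \<open>1 - 2x\<close>; the point here follows the second so closely that all orders below
  \<open>x^4\<close> cancel.\<close>

lemma Q_scaled_upper_neg: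
  fixes x :: real
  assumes "0 < x" "x \<le> 1 / 59"
  shows "Q_scaled x (1 - 2 * x - 2 * x ^ 2) < 0"
proof -
  have pow: "x ^ Suc n \<le> 1 / 59" for n
    using mult_mono[OF assms(2), of "x ^ n" 1] power_le_one[of x n] assms by simp
  have bounds: "x ^ 2 \<le> 1 / 59" "x ^ 3 \<le> 1 / 59" "x ^ 4 \<le> 1 / 59" "x ^ 5 \<le> 1 / 59" "x ^ 6 \<le> 1 / 59"
    using pow[of 1] pow[of 2] pow[of 3] pow[of 4] pow[of 5] by (simp_all add: numeral_eq_Suc)
  \<comment> \<open>The grouping lets the constant of each block absorb the negative terms of that
    block.\<close>
  have "Q_scaled x (1 - 2 * x - 2 * x ^ 2) = - (x ^ 4 *
      ((80 - 800 * x) + x ^ 2 * (2208 + 2144 * x - 16320 * x ^ 2 + 960 * x ^ 3)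
       + x ^ 6 * (57536 - 2048 * x - 128336 * x ^ 2 - 46048 * x ^ 3)
       + x ^ 10 * (158624 + 150560 * x - 32208 * x ^ 2 - 121856 * x ^ 3
                   - 78960 * x ^ 4 - 22912 * x ^ 5 - 2624 * x ^ 6)))"
    unfolding Q_scaled_def by algebra
  moreover have "80 - 800 * x > 0"
    using assms by simp
  moreover have "2208 + 2144 * x - 16320 * x ^ 2 + 960 * x ^ 3 \<ge> 0"
    using assms bounds zero_le_power[of x 3] by linarith
  moreover have "57536 - 2048 * x - 128336 * x ^ 2 - 46048 * x ^ 3 \<ge> 0"
    using assms bounds by linarith
  moreover have "158624 + 150560 * x - 32208 * x ^ 2 - 121856 * x ^ 3
                   - 78960 * x ^ 4 - 22912 * x ^ 5 - 2624 * x ^ 6 \<ge> 0"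
    using assms bounds by linarith
  ultimately show ?thesis
    using assms by (simp add: add_pos_nonneg)
qed

text \<open>Adding \<open>c * x^3\<close> to \<open>1 - 2x - 2x^2\<close> turns the
  \<open>x^4\<close> coefficient into \<open>-80 - 16c\<close>, which is positive for
  \<open>c < -5\<close>; \<open>c = -9\<close> gives 64.\<close>

lemma Q_scaled_lower_pos:
  fixes x :: real
  assumes "0 < x" "x \<le> 1 / 59"
  shows "Q_scaled x (1 - 2 * x - 2 * x ^ 2 - 9 * x ^ 3) > 0"
proof -
  have pow: "x ^ Suc n \<le> 1 / 59" for n
    using mult_mono[OF assms(2), of "x ^ n" 1] power_le_one[of x n] assms by simp
  \<comment> \<open>Bounding each power by \<open>1 / 59\<close> alone is too weak for the cubic
    block below: its negative coefficients add up to more than 59 times its constant.\<close>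
  have bounds: "x ^ 2 \<le> x / 59" "x ^ 3 \<le> x / 59"
    using mult_left_mono[OF pow[of 0], of x] mult_left_mono[OF pow[of 1], of x] assms
    by (simp_all add: numeral_eq_Suc)
  have "Q_scaled x (1 - 2 * x - 2 * x ^ 2 - 9 * x ^ 3) = x ^ 4 *
      ((64 - 1216 * x)
       + x ^ 2 * (7764 - 22808 * x)
       + x ^ 4 * (67548 - 298212 * x)
       + x ^ 6 * (695512 - 1192756 * x)
       + x ^ 8 * (4977293 - 9201524 * x)
       + x ^ 10 * (8642539 - 51673346 * x)
       + x ^ 12 * (59671914 - 16131892 * x)
       + x ^ 14 * (399188685 - 46585244 * x)
       + x ^ 16 * (63739283 - 2075527080 * x - 2025575829 * x ^ 2 - 3090958542 * x ^ 3)
       + x ^ 20 * (2669939901 + 7325382744 * x + 16334370576 * x ^ 2 + 16673429934 * x ^ 3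
                   + 15755099886 * x ^ 4 + 7748409780 * x ^ 5 + 3486784401 * x ^ 6))"
    unfolding Q_scaled_def by algebra
  moreover have "63739283 - 2075527080 * x - 2025575829 * x ^ 2 - 3090958542 * x ^ 3 \<ge> 0"
    using assms bounds by linarith
  ultimately show ?thesis
    using assms by (simp add: add_pos_nonneg)
qed

theorem theorem4p2:
  fixes p q :: int
  assumes "p > 0" and "q > 0" and "coprime p q" and "p \<ge> 59 * q"
  shows "\<exists>t::real. Q p q t = 0
           \<and> of_int (p ^ 2 - 2 * q * p - 2 * q ^ 2) - 9 * of_int q ^ 3 / of_int p < t
           \<and> t < of_int (p ^ 2 - 2 * q * p - 2 * q ^ 2)"
proof -
  define x where "x = real_of_int q / of_int p"
  have p: "real_of_int p > 0" and q: "real_of_int q = x * of_int p"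
    using assms by (simp_all add: x_def)
  have "59 * real_of_int q \<le> of_int p"
    using assms(4) by linarith
  then have x: "0 < x" "x \<le> 1 / 59"
    using assms by (simp_all add: x_def field_simps)
  let ?u = "1 - 2 * x - 2 * x ^ 2"
  let ?l = "?u - 9 * x ^ 3"
  have neg: "Q_scaled x ?u < 0" and pos: "Q_scaled x ?l > 0"
    using Q_scaled_upper_neg[OF x] Q_scaled_lower_pos[OF x] by auto
  have "?l \<le> ?u"
    using x by simp
  then obtain s where s: "?l \<le> s" "s \<le> ?u" "Q_scaled x s = 0"
    using IVT2'[of "Q_scaled x" ?u 0 ?l] neg pos continuous_on_Q_scaled by auto
  then have "?l < s" "s < ?u"
    using neg pos by (auto simp: less_le)
  then have "of_int p ^ 2 * ?l < of_int p ^ 2 * s" "of_int p ^ 2 * s < of_int p ^ 2 * ?u"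
    using p by simp_all
  moreover have upper: "of_int p ^ 2 * ?u = of_int (p ^ 2 - 2 * q * p - 2 * q ^ 2)"
    by (simp add: q algebra_simps power2_eq_square)
  \<comment> \<open>The fraction arises from \<open>p^2 * 9x^3\<close> with
    \<open>x = q / p\<close>.\<close>
  moreover have "of_int p ^ 2 * ?l =
      of_int (p ^ 2 - 2 * q * p - 2 * q ^ 2) - 9 * of_int q ^ 3 / of_int p"
    unfolding upper[symmetric] q using p
    by (simp add: field_simps power2_eq_square power3_eq_cube)
  moreover have "Q p q (of_int p ^ 2 * s) = 0"
    using Q_eq_Q_scaled[OF q] s(3) by simp
  ultimately show ?thesis
    by metis
qed

end
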